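(* Every $\ell^2$-product in a pre-Hilbert $*$-category is an $\ell^2$-biproduct.
   Context: A $*$-category is a category equipped with a choice of morphism $f^*\colon Y\to X$ for each morphism $f\colon X\to Y$ such that $1^*=1$, $(gf)^*=f^*g^*$ and $(f^* )^*=f$. A morphism $f$ is an isometry if $f^*f=1$, and a coisometry if $ff^*=1$. In a $*$-category with a zero object, a binary product $(r_1\colon X\to X_1,\ r_2\colon X\to X_2)$ is orthonormal if $r_1,r_2$ are coisometries and $r_1r_2^*=0$. A pre-Hilbert $*$-category is a $*$-category with a zero object, in which every pair of objects has an orthonormal product (written $X_1\oplus X_2$), every morphism has a kernel that is an isometry, and, for each object $X$, the diagonal $X\to X\oplus X$ (with both components $1$) is a kernel of some morphism. It is known that every pre-Hilbert $*$-category $\mathbf{C}$ is canonically enriched in rational vector spaces, with $(f+g)^*=f^*+g^*$, orthonormal products being biproducts. For each object $A$, the Hermitian elements ($a^*=a$) of $\mathbf{C}(A,A)$ are partially ordered by: $f\le g$ iff $g-f=h^*h$ for some morphism $h\colon A\to X$. For a set $J$, $\mathcal{F}J$ is the set of finite subsets of $J$, directed by inclusion. For a family $(a_j)_{j\in J}$ of positive elements ($a_j\ge 0$) of $\mathbf{C}(A,A)$, $\sum_{j\in J}a_j$ denotes $\sup_{F\in\mathcal{F}J}\sum_{j\in F}a_j$ (least upper bound, if it exists). Let $(X_j)_{j\in J}$ be a family of objects of $\mathbf{C}$. An $\ell^2$-span on it is a span $(g_j\colon Y\to X_j)_{j\in J}$ such that the net $(\sum_{j\in F}g_j^*g_j)_{F\in\mathcal{F}J}$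 in $\mathbf{C}(Y,Y)$ is bounded above. An $\ell^2$-product of $(X_j)_{j\in J}$ is an $\ell^2$-span $(r_j\colon X\to X_j)_{j\in J}$ such that for all $\ell^2$-spans $(g_j\colon Y\to X_j)_{j\in J}$ there is a unique morphism $g\colon Y\to X$ with $r_jg=g_j$ for all $j\in J$, and this $g$ satisfies $g^*g=\sum_{j\in J}g_j^*g_j$ (in particular this supremum exists). An $\ell^2$-biproduct of $(X_j)_{j\in J}$ is a span $(r_j\colon X\to X_j)_{j\in J}$ such that, for all $j,k\in J$, $r_jr_k^*=1$ if $j=k$ and $r_jr_k^*=0$ otherwise, and $\sum_{j\in J}r_j^*r_j=1$. *)

theory Defs
  imports "HOL-Algebra.Ring"
begin

section \<open>\<open>*\<close>-categories\<close>

text \<open>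
  The composite \<open>g \<cdot> f\<close> is ``\<open>g\<close> after \<open>f\<close>''; the operations are total functions, constrained
  only on the objects and on (composable) arrows.
\<close>

record ('o, 'm) star_structure =
  Obj :: "'o set"
  Arr :: "'m set"
  Dom :: "'m \<Rightarrow> 'o"
  Cod :: "'m \<Rightarrow> 'o"
  Ide :: "'o \<Rightarrow> 'm"
  Comp :: "'m \<Rightarrow> 'm \<Rightarrow> 'm" (infixr \<open>\<cdot>\<index>\<close> 75)
  Adj :: "'m \<Rightarrow> 'm" (\<open>_\<dagger>\<index>\<close> [1000] 999)

definition Mor :: "('o, 'm, 'z) star_structure_scheme \<Rightarrow> 'o \<Rightarrow> 'o \<Rightarrow> 'm set" where
  "Mor C A B = {f \<in> Arr C. Dom C f = A \<and> Cod C f = B}"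

locale star_category =
  fixes C :: "('o, 'm, 'z) star_structure_scheme" (structure)
  assumes Dom_Obj: "f \<in> Arr C \<Longrightarrow> Dom C f \<in> Obj C"
    and Cod_Obj: "f \<in> Arr C \<Longrightarrow> Cod C f \<in> Obj C"
    and Ide_Mor: "A \<in> Obj C \<Longrightarrow> Ide C A \<in> Mor C A A"
    and Comp_Mor: "\<lbrakk>f \<in> Mor C A B; g \<in> Mor C B D\<rbrakk> \<Longrightarrow> g \<cdot> f \<in> Mor C A D"
    and Comp_Ide: "f \<in> Mor C A B \<Longrightarrow> f \<cdot> Ide C A = f"
    and Ide_Comp: "f \<in> Mor C A B \<Longrightarrow> Ide C B \<cdot> f = f"
    and Comp_assoc: "\<lbrakk>f \<in> Mor C A B; g \<in> Mor C B D; h \<in> Mor C D E\<rbrakk>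
          \<Longrightarrow> (h \<cdot> g) \<cdot> f = h \<cdot> (g \<cdot> f)"
    and Adj_Mor: "f \<in> Mor C A B \<Longrightarrow> f\<dagger> \<in> Mor C B A"
    and Adj_Ide: "A \<in> Obj C \<Longrightarrow> (Ide C A)\<dagger> = Ide C A"
    and Adj_Comp: "\<lbrakk>f \<in> Mor C A B; g \<in> Mor C B D\<rbrakk> \<Longrightarrow> (g \<cdot> f)\<dagger> = f\<dagger> \<cdot> g\<dagger>"
    and Adj_Adj: "f \<in> Mor C A B \<Longrightarrow> (f\<dagger>)\<dagger> = f"

definition isometry :: "('o, 'm, 'z) star_structure_scheme \<Rightarrow> 'm \<Rightarrow> bool" where
  "isometry C f \<longleftrightarrow> f \<in> Arr C \<and> f\<dagger>\<^bsub>C\<^esub> \<cdot>\<^bsub>C\<^esub> f = Ide C (Dom C f)"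

definition coisometry :: "('o, 'm, 'z) star_structure_scheme \<Rightarrow> 'm \<Rightarrow> bool" where
  "coisometry C f \<longleftrightarrow> f \<in> Arr C \<and> f \<cdot>\<^bsub>C\<^esub> f\<dagger>\<^bsub>C\<^esub> = Ide C (Cod C f)"

definition zero_object :: "('o, 'm, 'z) star_structure_scheme \<Rightarrow> 'o \<Rightarrow> bool" where
  "zero_object C Z \<longleftrightarrow> Z \<in> Obj C \<and>
     (\<forall>A\<in>Obj C. (\<exists>!f. f \<in> Mor C A Z) \<and> (\<exists>!f. f \<in> Mor C Z A))"

text \<open>The unique morphism \<open>A \<rightarrow> B\<close> that factors through a zero object.\<close>

definition zero_mor :: "('o, 'm, 'z) star_structure_scheme \<Rightarrow> 'o \<Rightarrow> 'o \<Rightarrow> 'm" where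
  "zero_mor C A B =
     (THE f. \<exists>Z u v. zero_object C Z \<and> u \<in> Mor C A Z \<and> v \<in> Mor C Z B \<and> f = v \<cdot>\<^bsub>C\<^esub> u)"

definition is_kernel :: "('o, 'm, 'z) star_structure_scheme \<Rightarrow> 'm \<Rightarrow> 'm \<Rightarrow> bool" where
  "is_kernel C m f \<longleftrightarrow> f \<in> Arr C \<and> m \<in> Arr C \<and> Cod C m = Dom C f \<and>
     f \<cdot>\<^bsub>C\<^esub> m = zero_mor C (Dom C m) (Cod C f) \<and>
     (\<forall>Y\<in>Obj C. \<forall>g\<in>Mor C Y (Dom C f). f \<cdot>\<^bsub>C\<^esub> g = zero_mor C Y (Cod C f) \<longrightarrow>
        (\<exists>!h. h \<in> Mor C Y (Dom C m) \<and> m \<cdot>\<^bsub>C\<^esub> h = g))"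

definition binary_product ::
  "('o, 'm, 'z) star_structure_scheme \<Rightarrow> 'o \<Rightarrow> 'o \<Rightarrow> 'o \<Rightarrow> 'm \<Rightarrow> 'm \<Rightarrow> bool" where
  "binary_product C X\<^sub>1 X\<^sub>2 P r\<^sub>1 r\<^sub>2 \<longleftrightarrow>
     X\<^sub>1 \<in> Obj C \<and> X\<^sub>2 \<in> Obj C \<and> P \<in> Obj C \<and> r\<^sub>1 \<in> Mor C P X\<^sub>1 \<and> r\<^sub>2 \<in> Mor C P X\<^sub>2 \<and>
     (\<forall>Y\<in>Obj C. \<forall>f\<^sub>1\<in>Mor C Y X\<^sub>1. \<forall>f\<^sub>2\<in>Mor C Y X\<^sub>2.
        \<exists>!h. h \<in> Mor C Y P \<and> r\<^sub>1 \<cdot>\<^bsub>C\<^esub> h = f\<^sub>1 \<and> r\<^sub>2 \<cdot>\<^bsub>C\<^esub> h = f\<^sub>2)"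

definition orthonormal_product ::
  "('o, 'm, 'z) star_structure_scheme \<Rightarrow> 'o \<Rightarrow> 'o \<Rightarrow> 'o \<Rightarrow> 'm \<Rightarrow> 'm \<Rightarrow> bool" where
  "orthonormal_product C X\<^sub>1 X\<^sub>2 P r\<^sub>1 r\<^sub>2 \<longleftrightarrow>
     binary_product C X\<^sub>1 X\<^sub>2 P r\<^sub>1 r\<^sub>2 \<and> coisometry C r\<^sub>1 \<and> coisometry C r\<^sub>2 \<and>
     r\<^sub>1 \<cdot>\<^bsub>C\<^esub> r\<^sub>2\<dagger>\<^bsub>C\<^esub> = zero_mor C X\<^sub>2 X\<^sub>1"


section \<open>Pre-Hilbert \<open>*\<close>-categories\<close>

text \<open>
  Orthonormal products are unique up to unitary isomorphism, so in the last axiom it does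
  not matter which orthonormal product of \<open>X\<close> with itself is used as \<open>X \<oplus> X\<close>.
\<close>

locale pre_hilbert_star_category = star_category +
  assumes ex_zero_object: "\<exists>Z. zero_object C Z"
    and ex_orthonormal_product: "\<lbrakk>X\<^sub>1 \<in> Obj C; X\<^sub>2 \<in> Obj C\<rbrakk>
          \<Longrightarrow> \<exists>P r\<^sub>1 r\<^sub>2. orthonormal_product C X\<^sub>1 X\<^sub>2 P r\<^sub>1 r\<^sub>2"
    and ex_isometric_kernel: "f \<in> Arr C \<Longrightarrow> \<exists>m. is_kernel C m f \<and> isometry C m"
    and diagonal_kernel: "\<lbrakk>orthonormal_product C X X P r\<^sub>1 r\<^sub>2; d \<in> Mor C X P;
          r\<^sub>1 \<cdot> d = Ide C X; r\<^sub>2 \<cdot> d = Ide C X\<rbrakk> \<Longrightarrow> \<exists>f. is_kernel C d f"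

text \<open>
  The canonical addition of morphisms \<open>f, g : A \<rightarrow> B\<close>. In a pre-Hilbert \<open>*\<close>-category an
  orthonormal product \<open>(r\<^sub>1, r\<^sub>2)\<close> of \<open>B\<close> with itself is a biproduct with injections
  \<open>r\<^sub>1\<dagger>, r\<^sub>2\<dagger>\<close>, so the adjoint of the diagonal \<open>d\<close> is the codiagonal, and the sum is the usual
  composite \<open>A \<rightarrow> B \<oplus> B \<rightarrow> B\<close> of the pairing \<open>p\<close> of \<open>f\<close> and \<open>g\<close> with the codiagonal. It is
  independent of the chosen product.
\<close>

definition add_mor :: "('o, 'm, 'z) star_structure_scheme \<Rightarrow> 'm \<Rightarrow> 'm \<Rightarrow> 'm" where
  "add_mor C f g =
     (THE s. \<exists>P r\<^sub>1 r\<^sub>2 d p. orthonormal_product C (Cod C f) (Cod C f) P r\<^sub>1 r\<^sub>2 \<and>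
        d \<in> Mor C (Cod C f) P \<and> r\<^sub>1 \<cdot>\<^bsub>C\<^esub> d = Ide C (Cod C f) \<and> r\<^sub>2 \<cdot>\<^bsub>C\<^esub> d = Ide C (Cod C f) \<and>
        p \<in> Mor C (Dom C f) P \<and> r\<^sub>1 \<cdot>\<^bsub>C\<^esub> p = f \<and> r\<^sub>2 \<cdot>\<^bsub>C\<^esub> p = g \<and>
        s = d\<dagger>\<^bsub>C\<^esub> \<cdot>\<^bsub>C\<^esub> p)"

definition End_ring :: "('o, 'm, 'z) star_structure_scheme \<Rightarrow> 'o \<Rightarrow> 'm ring" where
  "End_ring C A = \<lparr>carrier = Mor C A A, mult = Comp C, one = Ide C A,
     zero = zero_mor C A A, add = add_mor C\<rparr>"

definition Herm_order :: "('o, 'm, 'z) star_structure_scheme \<Rightarrow> 'o \<Rightarrow> 'm gorder" where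
  "Herm_order C A = \<lparr>carrier = {a \<in> Mor C A A. a\<dagger>\<^bsub>C\<^esub> = a}, eq = (=),
     le = (\<lambda>f g. \<exists>X\<in>Obj C. \<exists>h\<in>Mor C A X. g \<ominus>\<^bsub>End_ring C A\<^esub> f = h\<dagger>\<^bsub>C\<^esub> \<cdot>\<^bsub>C\<^esub> h)\<rparr>"


section \<open>\<open>\<ell>\<^sup>2\<close>-products and \<open>\<ell>\<^sup>2\<close>-biproducts\<close>

definition partial_sums ::
  "('o, 'm, 'z) star_structure_scheme \<Rightarrow> 'o \<Rightarrow> 'j set \<Rightarrow> ('j \<Rightarrow> 'm) \<Rightarrow> 'm set" where
  "partial_sums C A J a = (\<lambda>F. finsum (End_ring C A) a F) ` Fpow J"

text \<open>\<open>is_sum C A J a s\<close>: the supremum defining \<open>\<Sum>j\<in>J. a j\<close> exists and equals \<open>s\<close>.\<close>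

definition is_sum ::
  "('o, 'm, 'z) star_structure_scheme \<Rightarrow> 'o \<Rightarrow> 'j set \<Rightarrow> ('j \<Rightarrow> 'm) \<Rightarrow> 'm \<Rightarrow> bool" where
  "is_sum C A J a s \<longleftrightarrow>
     least (Herm_order C A) s (Upper (Herm_order C A) (partial_sums C A J a))"

definition is_span ::
  "('o, 'm, 'z) star_structure_scheme \<Rightarrow> 'j set \<Rightarrow> ('j \<Rightarrow> 'o) \<Rightarrow> 'o \<Rightarrow> ('j \<Rightarrow> 'm) \<Rightarrow> bool" where
  "is_span C J X Y g \<longleftrightarrow> Y \<in> Obj C \<and> (\<forall>j\<in>J. g j \<in> Mor C Y (X j))"

definition l2_span ::
  "('o, 'm, 'z) star_structure_scheme \<Rightarrow> 'j set \<Rightarrow> ('j \<Rightarrow> 'o) \<Rightarrow> 'o \<Rightarrow> ('j \<Rightarrow> 'm) \<Rightarrow> bool" where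
  "l2_span C J X Y g \<longleftrightarrow> is_span C J X Y g \<and>
     Upper (Herm_order C Y) (partial_sums C Y J (\<lambda>j. (g j)\<dagger>\<^bsub>C\<^esub> \<cdot>\<^bsub>C\<^esub> g j)) \<noteq> {}"

definition l2_product ::
  "('o, 'm, 'z) star_structure_scheme \<Rightarrow> 'j set \<Rightarrow> ('j \<Rightarrow> 'o) \<Rightarrow> 'o \<Rightarrow> ('j \<Rightarrow> 'm) \<Rightarrow> bool" where
  "l2_product C J X P r \<longleftrightarrow> l2_span C J X P r \<and>
     (\<forall>Y g. l2_span C J X Y g \<longrightarrow>
        (\<exists>!h. h \<in> Mor C Y P \<and> (\<forall>j\<in>J. r j \<cdot>\<^bsub>C\<^esub> h = g j)) \<and>
        (\<forall>h. h \<in> Mor C Y P \<and> (\<forall>j\<in>J. r j \<cdot>\<^bsub>C\<^esub> h = g j) \<longrightarrow>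
           is_sum C Y J (\<lambda>j. (g j)\<dagger>\<^bsub>C\<^esub> \<cdot>\<^bsub>C\<^esub> g j) (h\<dagger>\<^bsub>C\<^esub> \<cdot>\<^bsub>C\<^esub> h)))"

definition l2_biproduct ::
  "('o, 'm, 'z) star_structure_scheme \<Rightarrow> 'j set \<Rightarrow> ('j \<Rightarrow> 'o) \<Rightarrow> 'o \<Rightarrow> ('j \<Rightarrow> 'm) \<Rightarrow> bool" where
  "l2_biproduct C J X P r \<longleftrightarrow> is_span C J X P r \<and>
     (\<forall>j\<in>J. \<forall>k\<in>J. r j \<cdot>\<^bsub>C\<^esub> (r k)\<dagger>\<^bsub>C\<^esub> = (if j = k then Ide C (X j) else zero_mor C (X k) (X j))) \<and>
     is_sum C P J (\<lambda>j. (r j)\<dagger>\<^bsub>C\<^esub> \<cdot>\<^bsub>C\<^esub> r j) (Ide C P)"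

end

theory Submission
  imports Defs
begin

text \<open>
  Let \<open>(r\<^sub>j : P \<rightarrow> X\<^sub>j)\<close> be an \<open>\<ell>\<^sup>2\<close>-product. The identity of \<open>P\<close> is the comparison
  morphism of \<open>r\<close> with itself, so \<open>\<Sum>j. r\<^sub>j\<dagger> r\<^sub>j = 1\<close>; in particular \<open>r\<^sub>k\<dagger> r\<^sub>k \<le> 1\<close>,
  say \<open>1 = h\<dagger> h + r\<^sub>k\<dagger> r\<^sub>k\<close>.
  For fixed \<open>k\<close> the span on \<open>X\<^sub>k\<close> with components \<open>\<delta>\<^sub>j\<^sub>k\<close> has partial sums \<open>0\<close> and \<open>1\<close>
  only, hence is an \<open>\<ell>\<^sup>2\<close>-span; it induces \<open>s : X\<^sub>k \<rightarrow> P\<close> with \<open>r\<^sub>j s = \<delta>\<^sub>j\<^sub>k\<close>, and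
  \<open>s\<dagger> s\<close> is the least upper bound of these partial sums, so \<open>s\<dagger> s \<le> 1\<close>, say \<open>1 = t\<dagger> t + s\<dagger> s\<close>. Now
  \<open>s\<dagger> s = (h s)\<dagger> (h s) + (r\<^sub>k s)\<dagger> (r\<^sub>k s) = (h s)\<dagger> (h s) + t\<dagger> t + s\<dagger> s\<close>,
  so \<open>(h s)\<dagger> (h s) + t\<dagger> t = 0\<close>, and \<open>h s = 0\<close> because sums of positive elements vanish
  only if the summands do (lemma \<open>add_positive_eq_zero\<close>). Therefore
  \<open>s = h\<dagger> h s + r\<^sub>k\<dagger> r\<^sub>k s = r\<^sub>k\<dagger>\<close>, and \<open>r\<^sub>j r\<^sub>k\<dagger> = r\<^sub>j s = \<delta>\<^sub>j\<^sub>k\<close>.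

  Lemma \<open>contractive_section_eq_Adj\<close> carries out this computation.

  It uses that each \<open>C(A, A)\<close> is an abelian group under the canonical addition, over which
  composition distributes. Orthonormal products are biproducts, which makes the hom-sets
  commutative monoids with bilinear composition; additive inverses come from the diagonals
  being kernels (lemma \<open>ex_neg_Ide\<close>).
\<close>

section \<open>Zero morphisms and isometric kernels\<close>

context star_category
begin

lemma Mor_Obj:
  assumes "f \<in> Mor C A B"
  shows "A \<in> Obj C" and "B \<in> Obj C"
  using assms Dom_Obj Cod_Obj unfolding Mor_def by auto

end

context pre_hilbert_star_category
begin

lemma zero_object_unique:
  assumes "zero_object C Z"
  shows "\<lbrakk>f \<in> Mor C A Z; g \<in> Mor C A Z\<rbrakk> \<Longrightarrow> f = g"
    and "\<lbrakk>f \<in> Mor C Z A; g \<in> Mor C Z A\<rbrakk> \<Longrightarrow> f = g"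
  using assms Mor_Obj(1)[of f A Z] Mor_Obj(2)[of f Z A] unfolding zero_object_def by metis+

lemma zero_object_Mor:
  assumes "zero_object C Z" "A \<in> Obj C"
  obtains u v where "u \<in> Mor C A Z" "v \<in> Mor C Z A"
  using assms unfolding zero_object_def by metis

lemma zero_mor_eqI:
  assumes Z: "zero_object C Z" and u: "u \<in> Mor C A Z" and v: "v \<in> Mor C Z B"
  shows "zero_mor C A B = v \<cdot> u"
  unfolding zero_mor_def
proof (rule the_equality)
  show "\<exists>Z u' v'. zero_object C Z \<and> u' \<in> Mor C A Z \<and> v' \<in> Mor C Z B \<and> v \<cdot> u = v' \<cdot> u'"
    using assms by blast
next
  fix f assume "\<exists>Z u v. zero_object C Z \<and> u \<in> Mor C A Z \<and> v \<in> Mor C Z B \<and> f = v \<cdot> u"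
  then obtain Z' u' v' where Z': "zero_object C Z'" and u': "u' \<in> Mor C A Z'"
    and v': "v' \<in> Mor C Z' B" and f: "f = v' \<cdot> u'" by blast
  obtain t where t: "t \<in> Mor C Z Z'" using zero_object_Mor[OF Z' Mor_Obj(2)[OF u]] .
  have "t \<cdot> u = u'" by (rule zero_object_unique(1)[OF Z' Comp_Mor[OF u t] u'])
  moreover have "v' \<cdot> t = v" by (rule zero_object_unique(2)[OF Z Comp_Mor[OF t v'] v])
  ultimately show "f = v \<cdot> u" using Comp_assoc[OF u t v'] f by simp
qed

lemma zero_mor_factors:
  assumes "A \<in> Obj C" "B \<in> Obj C"
  obtains Z u v where "zero_object C Z" "u \<in> Mor C A Z" "v \<in> Mor C Z B" "zero_mor C A B = v \<cdot> u"
proof -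
  obtain Z where Z: "zero_object C Z" using ex_zero_object by blast
  obtain u where u: "u \<in> Mor C A Z" using zero_object_Mor[OF Z assms(1)] .
  obtain v where v: "v \<in> Mor C Z B" using zero_object_Mor[OF Z assms(2)] .
  show ?thesis by (rule that[OF Z u v zero_mor_eqI[OF Z u v]])
qed

lemma zero_mor_Mor:
  assumes "A \<in> Obj C" "B \<in> Obj C"
  shows "zero_mor C A B \<in> Mor C A B"
  using zero_mor_factors[OF assms] Comp_Mor by metis

lemma Comp_zero_mor:
  assumes f: "f \<in> Mor C B D" and A: "A \<in> Obj C"
  shows "f \<cdot> zero_mor C A B = zero_mor C A D"
proof -
  obtain Z u v where Z: "zero_object C Z" and u: "u \<in> Mor C A Z" and v: "v \<in> Mor C Z B"
    and eq: "zero_mor C A B = v \<cdot> u" using zero_mor_factors[OF A Mor_Obj(1)[OF f]] .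
  show ?thesis using zero_mor_eqI[OF Z u Comp_Mor[OF v f]] Comp_assoc[OF u v f] eq by simp
qed

lemma zero_mor_Comp:
  assumes f: "f \<in> Mor C A B" and D: "D \<in> Obj C"
  shows "zero_mor C B D \<cdot> f = zero_mor C A D"
proof -
  obtain Z u v where Z: "zero_object C Z" and u: "u \<in> Mor C B Z" and v: "v \<in> Mor C Z D"
    and eq: "zero_mor C B D = v \<cdot> u" using zero_mor_factors[OF Mor_Obj(2)[OF f] D] .
  show ?thesis using zero_mor_eqI[OF Z Comp_Mor[OF f u] v] Comp_assoc[OF f u v] eq by simp
qed

lemma Adj_zero_mor:
  assumes "A \<in> Obj C" "B \<in> Obj C"
  shows "(zero_mor C A B)\<dagger> = zero_mor C B A"
proof -
  obtain Z u v where Z: "zero_object C Z" and u: "u \<in> Mor C A Z" and v: "v \<in> Mor C Z B"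
    and eq: "zero_mor C A B = v \<cdot> u" using zero_mor_factors[OF assms] .
  show ?thesis using zero_mor_eqI[OF Z Adj_Mor[OF v] Adj_Mor[OF u]] Adj_Comp[OF u v] eq by simp
qed

lemma isometric_kernel:
  assumes f: "f \<in> Mor C A B"
  obtains K m where "m \<in> Mor C K A" "m\<dagger> \<cdot> m = Ide C K" "f \<cdot> m = zero_mor C K B"
    "\<And>Y g. g \<in> Mor C Y A \<Longrightarrow> f \<cdot> g = zero_mor C Y B \<Longrightarrow> \<exists>h\<in>Mor C Y K. m \<cdot> h = g"
proof -
  have arr: "f \<in> Arr C" "Dom C f = A" "Cod C f = B" using f by (auto simp: Mor_def)
  obtain m where m: "is_kernel C m f" "isometry C m" using ex_isometric_kernel arr by blast
  show ?thesis
  proof (rule that)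
    show "m \<in> Mor C (Dom C m) A" using m(1) arr by (auto simp: is_kernel_def Mor_def)
    show "m\<dagger> \<cdot> m = Ide C (Dom C m)" using m(2) by (simp add: isometry_def)
    show "f \<cdot> m = zero_mor C (Dom C m) B" using m(1) arr by (auto simp: is_kernel_def)
    show "\<exists>h\<in>Mor C Y (Dom C m). m \<cdot> h = g"
      if "g \<in> Mor C Y A" "f \<cdot> g = zero_mor C Y B" for Y g
      using m(1) arr that Mor_Obj(1)[OF that(1)] unfolding is_kernel_def by metis
  qed
qed

text \<open>
  Positive definiteness: if \<open>f\<dagger> f = 0\<close>, then \<open>f = m h\<close> for an isometric kernel \<open>m\<close> of
  \<open>f\<dagger>\<close>, and \<open>h\<dagger> = h\<dagger> m\<dagger> m = f\<dagger> m = 0\<close>.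
\<close>

lemma Adj_Comp_self_eq_zero:
  assumes f: "f \<in> Mor C A B" and ff: "f\<dagger> \<cdot> f = zero_mor C A A"
  shows "f = zero_mor C A B"
proof -
  note f' = Adj_Mor[OF f]
  obtain K m where m: "m \<in> Mor C K B" "m\<dagger> \<cdot> m = Ide C K" "f\<dagger> \<cdot> m = zero_mor C K A"
    and univ: "\<And>Y g. g \<in> Mor C Y B \<Longrightarrow> f\<dagger> \<cdot> g = zero_mor C Y A \<Longrightarrow> \<exists>h\<in>Mor C Y K. m \<cdot> h = g"
    by (rule isometric_kernel[OF f'], rule that)
  obtain h where h: "h \<in> Mor C A K" "m \<cdot> h = f" using univ[OF f ff] by blast
  have "h\<dagger> = h\<dagger> \<cdot> (m\<dagger> \<cdot> m)" using m Comp_Ide[OF Adj_Mor[OF h(1)]] by simp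
  also have "\<dots> = (h\<dagger> \<cdot> m\<dagger>) \<cdot> m"
    using Comp_assoc[OF m(1) Adj_Mor[OF m(1)] Adj_Mor[OF h(1)]] by simp
  also have "h\<dagger> \<cdot> m\<dagger> = f\<dagger>" using Adj_Comp[OF h(1) m(1)] h by simp
  finally have "h\<dagger> = zero_mor C K A" using m by simp
  then have "h = zero_mor C A K"
    using Adj_Adj[OF h(1)] Adj_zero_mor Mor_Obj[OF h(1)] by metis
  then show ?thesis using h Comp_zero_mor[OF m(1)] Mor_Obj(1)[OF f] by simp
qed


section \<open>Orthonormal products are biproducts\<close>

lemma orthonormal_productD:
  assumes "orthonormal_product C X\<^sub>1 X\<^sub>2 P r\<^sub>1 r\<^sub>2"
  shows "X\<^sub>1 \<in> Obj C" "X\<^sub>2 \<in> Obj C" "P \<in> Obj C" "r\<^sub>1 \<in> Mor C P X\<^sub>1" "r\<^sub>2 \<in> Mor C P X\<^sub>2"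
    "r\<^sub>1 \<cdot> r\<^sub>1\<dagger> = Ide C X\<^sub>1" "r\<^sub>2 \<cdot> r\<^sub>2\<dagger> = Ide C X\<^sub>2"
    "r\<^sub>1 \<cdot> r\<^sub>2\<dagger> = zero_mor C X\<^sub>2 X\<^sub>1" "r\<^sub>2 \<cdot> r\<^sub>1\<dagger> = zero_mor C X\<^sub>1 X\<^sub>2"
proof -
  show *: "X\<^sub>1 \<in> Obj C" "X\<^sub>2 \<in> Obj C" "P \<in> Obj C" "r\<^sub>1 \<in> Mor C P X\<^sub>1" "r\<^sub>2 \<in> Mor C P X\<^sub>2"
    "r\<^sub>1 \<cdot> r\<^sub>1\<dagger> = Ide C X\<^sub>1" "r\<^sub>2 \<cdot> r\<^sub>2\<dagger> = Ide C X\<^sub>2" "r\<^sub>1 \<cdot> r\<^sub>2\<dagger> = zero_mor C X\<^sub>2 X\<^sub>1"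
    using assms
    by (auto simp: orthonormal_product_def binary_product_def coisometry_def Mor_def)
  have "r\<^sub>2 \<cdot> r\<^sub>1\<dagger> = (r\<^sub>1 \<cdot> r\<^sub>2\<dagger>)\<dagger>"
    using Adj_Comp[OF Adj_Mor[OF *(5)] *(4)] Adj_Adj[OF *(5)] by simp
  then show "r\<^sub>2 \<cdot> r\<^sub>1\<dagger> = zero_mor C X\<^sub>1 X\<^sub>2" using * Adj_zero_mor by simp
qed

lemma orthonormal_product_commute:
  assumes "orthonormal_product C X\<^sub>1 X\<^sub>2 P r\<^sub>1 r\<^sub>2"
  shows "orthonormal_product C X\<^sub>2 X\<^sub>1 P r\<^sub>2 r\<^sub>1"
proof -
  have "binary_product C X\<^sub>2 X\<^sub>1 P r\<^sub>2 r\<^sub>1"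
    using assms unfolding orthonormal_product_def binary_product_def by metis
  then show ?thesis
    using assms orthonormal_productD(9)[OF assms] unfolding orthonormal_product_def by simp
qed

lemma pairing:
  assumes "orthonormal_product C X\<^sub>1 X\<^sub>2 P r\<^sub>1 r\<^sub>2" "f \<in> Mor C Y X\<^sub>1" "g \<in> Mor C Y X\<^sub>2"
  obtains p where "p \<in> Mor C Y P" "r\<^sub>1 \<cdot> p = f" "r\<^sub>2 \<cdot> p = g"
  using assms Mor_Obj[OF assms(2)] unfolding orthonormal_product_def binary_product_def by blast

lemma pairing_unique:
  assumes P: "orthonormal_product C X\<^sub>1 X\<^sub>2 P r\<^sub>1 r\<^sub>2" and p: "p \<in> Mor C Y P" "p' \<in> Mor C Y P"
    and eq: "r\<^sub>1 \<cdot> p = r\<^sub>1 \<cdot> p'" "r\<^sub>2 \<cdot> p = r\<^sub>2 \<cdot> p'"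
  shows "p = p'"
proof -
  note D = orthonormal_productD[OF P]
  have "\<exists>!h. h \<in> Mor C Y P \<and> r\<^sub>1 \<cdot> h = r\<^sub>1 \<cdot> p \<and> r\<^sub>2 \<cdot> h = r\<^sub>2 \<cdot> p"
    using P Mor_Obj(1)[OF p(1)] Comp_Mor[OF p(1) D(4)] Comp_Mor[OF p(1) D(5)]
    unfolding orthonormal_product_def binary_product_def by blast
  then show ?thesis using p eq by metis
qed

lemma copairing:
  assumes P: "orthonormal_product C X\<^sub>1 X\<^sub>2 P r\<^sub>1 r\<^sub>2" and fg: "f \<in> Mor C X\<^sub>1 Y" "g \<in> Mor C X\<^sub>2 Y"
  obtains q where "q \<in> Mor C P Y" "q \<cdot> r\<^sub>1\<dagger> = f" "q \<cdot> r\<^sub>2\<dagger> = g"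
proof -
  note D = orthonormal_productD[OF P]
  obtain p where p: "p \<in> Mor C Y P" "r\<^sub>1 \<cdot> p = f\<dagger>" "r\<^sub>2 \<cdot> p = g\<dagger>"
    using pairing[OF P Adj_Mor[OF fg(1)] Adj_Mor[OF fg(2)]] .
  show ?thesis
    using that[OF Adj_Mor[OF p(1)]] Adj_Comp[OF p(1) D(4)] Adj_Comp[OF p(1) D(5)] p
      Adj_Adj[OF fg(1)] Adj_Adj[OF fg(2)] by simp
qed

lemma copairing_unique:
  assumes P: "orthonormal_product C X\<^sub>1 X\<^sub>2 P r\<^sub>1 r\<^sub>2" and q: "q \<in> Mor C P Y" "q' \<in> Mor C P Y"
    and eq: "q \<cdot> r\<^sub>1\<dagger> = q' \<cdot> r\<^sub>1\<dagger>" "q \<cdot> r\<^sub>2\<dagger> = q' \<cdot> r\<^sub>2\<dagger>"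
  shows "q = q'"
proof -
  note D = orthonormal_productD[OF P]
  have *: "r\<^sub>i \<cdot> x\<dagger> = (x \<cdot> r\<^sub>i\<dagger>)\<dagger>" if "x \<in> Mor C P Y" "r\<^sub>i \<in> Mor C P X\<^sub>i" for x r\<^sub>i X\<^sub>i
    using Adj_Comp[OF Adj_Mor[OF that(2)] that(1)] Adj_Adj[OF that(2)] by simp
  have "q\<dagger> = q'\<dagger>"
    using pairing_unique[OF P Adj_Mor[OF q(1)] Adj_Mor[OF q(2)]]
      *[OF q(1) D(4)] *[OF q(2) D(4)] *[OF q(1) D(5)] *[OF q(2) D(5)] eq by simp
  then show ?thesis using Adj_Adj q by metis
qed

text \<open>
  For a second orthonormal product \<open>(s\<^sub>1, s\<^sub>2)\<close>, a morphism \<open>u\<close> of the form \<open>h \<oplus> h\<close> is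
  compatible with the injections as well as with the projections.
\<close>

lemma product_mor_injections:
  assumes P: "orthonormal_product C B B P r\<^sub>1 r\<^sub>2" and Q: "orthonormal_product C D D Q s\<^sub>1 s\<^sub>2"
    and h: "h \<in> Mor C B D" and u: "u \<in> Mor C P Q" "s\<^sub>1 \<cdot> u = h \<cdot> r\<^sub>1" "s\<^sub>2 \<cdot> u = h \<cdot> r\<^sub>2"
  shows "u \<cdot> r\<^sub>1\<dagger> = s\<^sub>1\<dagger> \<cdot> h" and "u \<cdot> r\<^sub>2\<dagger> = s\<^sub>2\<dagger> \<cdot> h"
proof -
  note DP = orthonormal_productD[OF P]
  note DQ = orthonormal_productD[OF Q]
  have L: "s \<cdot> (u \<cdot> r\<dagger>) = h \<cdot> (r' \<cdot> r\<dagger>)"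
    if "r \<in> Mor C P B" "r' \<in> Mor C P B" "s \<in> Mor C Q D" "s \<cdot> u = h \<cdot> r'" for r r' s
    using Comp_assoc[OF Adj_Mor[OF that(1)] u(1) that(3)]
      Comp_assoc[OF Adj_Mor[OF that(1)] that(2) h] that(4) by simp
  have R: "s \<cdot> (s'\<dagger> \<cdot> h) = (s \<cdot> s'\<dagger>) \<cdot> h" if "s \<in> Mor C Q D" "s' \<in> Mor C Q D" for s s'
    using Comp_assoc[OF h Adj_Mor[OF that(2)] that(1)] by simp
  note z = Comp_Ide[OF h] Ide_Comp[OF h] Comp_zero_mor[OF h DP(1)] zero_mor_Comp[OF h DQ(1)]
  show "u \<cdot> r\<^sub>1\<dagger> = s\<^sub>1\<dagger> \<cdot> h"
    by (rule pairing_unique[OF Q Comp_Mor[OF Adj_Mor[OF DP(4)] u(1)] Comp_Mor[OF h Adj_Mor[OF DQ(4)]]])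
      (simp_all add: L[OF DP(4) DP(4) DQ(4) u(2)] L[OF DP(4) DP(5) DQ(5) u(3)]
        R[OF DQ(4) DQ(4)] R[OF DQ(5) DQ(4)] DP DQ z)
  show "u \<cdot> r\<^sub>2\<dagger> = s\<^sub>2\<dagger> \<cdot> h"
    by (rule pairing_unique[OF Q Comp_Mor[OF Adj_Mor[OF DP(5)] u(1)] Comp_Mor[OF h Adj_Mor[OF DQ(5)]]])
      (simp_all add: L[OF DP(5) DP(4) DQ(4) u(2)] L[OF DP(5) DP(5) DQ(5) u(3)]
        R[OF DQ(4) DQ(5)] R[OF DQ(5) DQ(5)] DP DQ z)
qed

text \<open>Hence codiagonals \<open>q\<close>, \<open>q'\<close> are natural.\<close>

lemma codiagonal_natural:
  assumes P: "orthonormal_product C B B P r\<^sub>1 r\<^sub>2" and Q: "orthonormal_product C D D Q s\<^sub>1 s\<^sub>2"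
    and h: "h \<in> Mor C B D" and u: "u \<in> Mor C P Q" "s\<^sub>1 \<cdot> u = h \<cdot> r\<^sub>1" "s\<^sub>2 \<cdot> u = h \<cdot> r\<^sub>2"
    and q: "q \<in> Mor C P B" "q \<cdot> r\<^sub>1\<dagger> = Ide C B" "q \<cdot> r\<^sub>2\<dagger> = Ide C B"
    and q': "q' \<in> Mor C Q D" "q' \<cdot> s\<^sub>1\<dagger> = Ide C D" "q' \<cdot> s\<^sub>2\<dagger> = Ide C D"
  shows "q' \<cdot> u = h \<cdot> q"
proof -
  note DP = orthonormal_productD[OF P]
  note DQ = orthonormal_productD[OF Q]
  have *: "(q' \<cdot> u) \<cdot> r\<dagger> = (h \<cdot> q) \<cdot> r\<dagger>"
    if "r \<in> Mor C P B" "s \<in> Mor C Q D" "u \<cdot> r\<dagger> = s\<dagger> \<cdot> h" "q \<cdot> r\<dagger> = Ide C B" "q' \<cdot> s\<dagger> = Ide C D"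
    for r s
    using Comp_assoc[OF Adj_Mor[OF that(1)] u(1) q'(1)]
      Comp_assoc[OF Adj_Mor[OF that(1)] q(1) h] Comp_assoc[OF h Adj_Mor[OF that(2)] q'(1)]
      that(3-5) Comp_Ide[OF h] Ide_Comp[OF h] by simp
  note i = product_mor_injections[OF P Q h u]
  show ?thesis
    by (rule copairing_unique[OF P Comp_Mor[OF u(1) q'(1)] Comp_Mor[OF q(1) h]
      *[OF DP(4) DQ(4) i(1) q(2) q'(2)] *[OF DP(5) DQ(5) i(2) q(3) q'(3)]])
qed


section \<open>The canonical addition\<close>

abbreviation plus_mor (infixl \<open>\<boxplus>\<close> 65) where
  "f \<boxplus> g \<equiv> add_mor C f g"

lemma add_mor_eqI:
  assumes P: "orthonormal_product C B B P r\<^sub>1 r\<^sub>2"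
    and q: "q \<in> Mor C P B" "q \<cdot> r\<^sub>1\<dagger> = Ide C B" "q \<cdot> r\<^sub>2\<dagger> = Ide C B"
    and p: "p \<in> Mor C A P" "r\<^sub>1 \<cdot> p = f" "r\<^sub>2 \<cdot> p = g"
  shows "f \<boxplus> g = q \<cdot> p"
proof -
  note D = orthonormal_productD[OF P]
  have f: "f \<in> Mor C A B" using Comp_Mor[OF p(1) D(4)] p by simp
  have dom: "Dom C f = A" "Cod C f = B" using f by (auto simp: Mor_def)
  have adj: "r \<cdot> q\<dagger> = Ide C B" if "r \<in> Mor C P B" "q \<cdot> r\<dagger> = Ide C B" for r
    using Adj_Comp[OF Adj_Mor[OF that(1)] q(1)] Adj_Adj[OF that(1)] Adj_Ide[OF D(1)] that by simp
  show ?thesis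
    unfolding add_mor_def dom
  proof (rule the_equality)
    show "\<exists>P r\<^sub>1 r\<^sub>2 d p'. orthonormal_product C B B P r\<^sub>1 r\<^sub>2 \<and> d \<in> Mor C B P \<and>
        r\<^sub>1 \<cdot> d = Ide C B \<and> r\<^sub>2 \<cdot> d = Ide C B \<and>
        p' \<in> Mor C A P \<and> r\<^sub>1 \<cdot> p' = f \<and> r\<^sub>2 \<cdot> p' = g \<and> q \<cdot> p = d\<dagger> \<cdot> p'"
      by (rule exI[of _ P], rule exI[of _ r\<^sub>1], rule exI[of _ r\<^sub>2], rule exI[of _ "q\<dagger>"],
          rule exI[of _ p])
        (simp add: P Adj_Mor[OF q(1)] Adj_Adj[OF q(1)] adj[OF D(4) q(2)] adj[OF D(5) q(3)] p)
  next
    fix s assume "\<exists>P r\<^sub>1 r\<^sub>2 d p. orthonormal_product C B B P r\<^sub>1 r\<^sub>2 \<and> d \<in> Mor C B P \<and>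
        r\<^sub>1 \<cdot> d = Ide C B \<and> r\<^sub>2 \<cdot> d = Ide C B \<and>
        p \<in> Mor C A P \<and> r\<^sub>1 \<cdot> p = f \<and> r\<^sub>2 \<cdot> p = g \<and> s = d\<dagger> \<cdot> p"
    then obtain Q s\<^sub>1 s\<^sub>2 d p' where Q: "orthonormal_product C B B Q s\<^sub>1 s\<^sub>2"
      and d: "d \<in> Mor C B Q" "s\<^sub>1 \<cdot> d = Ide C B" "s\<^sub>2 \<cdot> d = Ide C B"
      and p': "p' \<in> Mor C A Q" "s\<^sub>1 \<cdot> p' = f" "s\<^sub>2 \<cdot> p' = g" and s: "s = d\<dagger> \<cdot> p'"
      by blast
    note DQ = orthonormal_productD[OF Q]
    obtain u where u: "u \<in> Mor C P Q" "s\<^sub>1 \<cdot> u = r\<^sub>1" "s\<^sub>2 \<cdot> u = r\<^sub>2"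
      using pairing[OF Q D(4,5)] .
    have "u \<cdot> p = p'"
      by (rule pairing_unique[OF Q Comp_Mor[OF p(1) u(1)] p'(1)])
        (simp_all add: Comp_assoc[OF p(1) u(1) DQ(4), symmetric]
          Comp_assoc[OF p(1) u(1) DQ(5), symmetric] u p p')
    moreover have "d\<dagger> \<cdot> u = q"
      using codiagonal_natural[OF P Q Ide_Mor[OF D(1)] u(1) _ _ q Adj_Mor[OF d(1)]]
        Adj_Comp[OF d(1) DQ(4)] Adj_Comp[OF d(1) DQ(5)] d Adj_Ide[OF D(1)] u
        Ide_Comp[OF D(4)] Ide_Comp[OF D(5)] Ide_Comp[OF q(1)] by simp
    ultimately show "s = q \<cdot> p" using s Comp_assoc[OF p(1) u(1) Adj_Mor[OF d(1)]] by simp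
  qed
qed

lemma add_mor_factors:
  assumes f: "f \<in> Mor C A B" and g: "g \<in> Mor C A B"
  obtains P r\<^sub>1 r\<^sub>2 q p where "orthonormal_product C B B P r\<^sub>1 r\<^sub>2"
    "q \<in> Mor C P B" "q \<cdot> r\<^sub>1\<dagger> = Ide C B" "q \<cdot> r\<^sub>2\<dagger> = Ide C B"
    "p \<in> Mor C A P" "r\<^sub>1 \<cdot> p = f" "r\<^sub>2 \<cdot> p = g" "f \<boxplus> g = q \<cdot> p"
proof -
  have B: "B \<in> Obj C" using Mor_Obj f by blast
  obtain P r\<^sub>1 r\<^sub>2 where P: "orthonormal_product C B B P r\<^sub>1 r\<^sub>2"
    using ex_orthonormal_product B by blast
  obtain q where q: "q \<in> Mor C P B" "q \<cdot> r\<^sub>1\<dagger> = Ide C B" "q \<cdot> r\<^sub>2\<dagger> = Ide C B"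
    using copairing[OF P Ide_Mor[OF B] Ide_Mor[OF B]] .
  obtain p where p: "p \<in> Mor C A P" "r\<^sub>1 \<cdot> p = f" "r\<^sub>2 \<cdot> p = g" using pairing[OF P f g] .
  show ?thesis using that[OF P q p add_mor_eqI[OF P q p]] .
qed

lemma add_mor_Mor:
  assumes "f \<in> Mor C A B" "g \<in> Mor C A B"
  shows "f \<boxplus> g \<in> Mor C A B"
  using add_mor_factors[OF assms] Comp_Mor by metis

lemma add_mor_Comp:
  assumes f: "f \<in> Mor C A B" "g \<in> Mor C A B" and k: "k \<in> Mor C D A"
  shows "(f \<boxplus> g) \<cdot> k = f \<cdot> k \<boxplus> g \<cdot> k"
proof -
  obtain P r\<^sub>1 r\<^sub>2 q p where P: "orthonormal_product C B B P r\<^sub>1 r\<^sub>2"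
    and q: "q \<in> Mor C P B" "q \<cdot> r\<^sub>1\<dagger> = Ide C B" "q \<cdot> r\<^sub>2\<dagger> = Ide C B"
    and p: "p \<in> Mor C A P" "r\<^sub>1 \<cdot> p = f" "r\<^sub>2 \<cdot> p = g" and eq: "f \<boxplus> g = q \<cdot> p"
    using add_mor_factors[OF f] .
  note D = orthonormal_productD[OF P]
  have "f \<cdot> k \<boxplus> g \<cdot> k = q \<cdot> (p \<cdot> k)"
    by (rule add_mor_eqI[OF P q Comp_Mor[OF k p(1)]])
      (simp_all add: Comp_assoc[OF k p(1) D(4), symmetric] Comp_assoc[OF k p(1) D(5), symmetric] p)
  then show ?thesis using eq Comp_assoc[OF k p(1) q(1)] by simp
qed

lemma Comp_add_mor:
  assumes f: "f \<in> Mor C A B" "g \<in> Mor C A B" and h: "h \<in> Mor C B D"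
  shows "h \<cdot> (f \<boxplus> g) = h \<cdot> f \<boxplus> h \<cdot> g"
proof -
  obtain P r\<^sub>1 r\<^sub>2 q p where P: "orthonormal_product C B B P r\<^sub>1 r\<^sub>2"
    and q: "q \<in> Mor C P B" "q \<cdot> r\<^sub>1\<dagger> = Ide C B" "q \<cdot> r\<^sub>2\<dagger> = Ide C B"
    and p: "p \<in> Mor C A P" "r\<^sub>1 \<cdot> p = f" "r\<^sub>2 \<cdot> p = g" and eq: "f \<boxplus> g = q \<cdot> p"
    using add_mor_factors[OF f] .
  note DP = orthonormal_productD[OF P]
  note hr = Comp_Mor[OF DP(4) h] Comp_Mor[OF DP(5) h]
  obtain Q s\<^sub>1 s\<^sub>2 q' u where Q: "orthonormal_product C D D Q s\<^sub>1 s\<^sub>2"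
    and q': "q' \<in> Mor C Q D" "q' \<cdot> s\<^sub>1\<dagger> = Ide C D" "q' \<cdot> s\<^sub>2\<dagger> = Ide C D"
    and u: "u \<in> Mor C P Q" "s\<^sub>1 \<cdot> u = h \<cdot> r\<^sub>1" "s\<^sub>2 \<cdot> u = h \<cdot> r\<^sub>2"
    using add_mor_factors[OF hr] by metis
  note DQ = orthonormal_productD[OF Q]
  have "h \<cdot> f \<boxplus> h \<cdot> g = q' \<cdot> (u \<cdot> p)"
    by (rule add_mor_eqI[OF Q q' Comp_Mor[OF p(1) u(1)]])
      (simp_all add: Comp_assoc[OF p(1) u(1) DQ(4), symmetric]
        Comp_assoc[OF p(1) u(1) DQ(5), symmetric] u
        Comp_assoc[OF p(1) DP(4) h] Comp_assoc[OF p(1) DP(5) h] p)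
  also have "\<dots> = (q' \<cdot> u) \<cdot> p" using Comp_assoc[OF p(1) u(1) q'(1)] by simp
  also have "\<dots> = (h \<cdot> q) \<cdot> p" using codiagonal_natural[OF P Q h u q q'] by simp
  also have "\<dots> = h \<cdot> (f \<boxplus> g)" using Comp_assoc[OF p(1) q(1) h] eq by simp
  finally show ?thesis by simp
qed

lemma add_mor_commute:
  assumes "f \<in> Mor C A B" "g \<in> Mor C A B"
  shows "f \<boxplus> g = g \<boxplus> f"
proof -
  obtain P r\<^sub>1 r\<^sub>2 q p where P: "orthonormal_product C B B P r\<^sub>1 r\<^sub>2"
    and q: "q \<in> Mor C P B" "q \<cdot> r\<^sub>1\<dagger> = Ide C B" "q \<cdot> r\<^sub>2\<dagger> = Ide C B"
    and p: "p \<in> Mor C A P" "r\<^sub>1 \<cdot> p = f" "r\<^sub>2 \<cdot> p = g" and eq: "f \<boxplus> g = q \<cdot> p"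
    using add_mor_factors[OF assms] .
  show ?thesis
    using add_mor_eqI[OF orthonormal_product_commute[OF P] q(1,3,2) p(1,3,2)] eq by simp
qed

lemma add_mor_zero:
  assumes f: "f \<in> Mor C A B"
  shows "f \<boxplus> zero_mor C A B = f"
proof -
  have O: "A \<in> Obj C" "B \<in> Obj C" using Mor_Obj f by blast+
  obtain P r\<^sub>1 r\<^sub>2 q p where P: "orthonormal_product C B B P r\<^sub>1 r\<^sub>2"
    and q: "q \<in> Mor C P B" "q \<cdot> r\<^sub>1\<dagger> = Ide C B" "q \<cdot> r\<^sub>2\<dagger> = Ide C B"
    using add_mor_factors[OF f f] by metis
  note D = orthonormal_productD[OF P]
  have "f \<boxplus> zero_mor C A B = q \<cdot> (r\<^sub>1\<dagger> \<cdot> f)"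
    by (rule add_mor_eqI[OF P q Comp_Mor[OF f Adj_Mor[OF D(4)]]])
      (simp_all add: Comp_assoc[OF f Adj_Mor[OF D(4)] D(4), symmetric]
        Comp_assoc[OF f Adj_Mor[OF D(4)] D(5), symmetric] D Ide_Comp[OF f] zero_mor_Comp[OF f O(2)])
  also have "\<dots> = f" using Comp_assoc[OF f Adj_Mor[OF D(4)] q(1)] q Ide_Comp[OF f] by simp
  finally show ?thesis .
qed

lemma add_mor_interchange:
  assumes a: "a \<in> Mor C A B" and b: "b \<in> Mor C A B" and c: "c \<in> Mor C A B" and d: "d \<in> Mor C A B"
  shows "(a \<boxplus> b) \<boxplus> (c \<boxplus> d) = (a \<boxplus> c) \<boxplus> (b \<boxplus> d)"
proof -
  obtain P r\<^sub>1 r\<^sub>2 q p where P: "orthonormal_product C B B P r\<^sub>1 r\<^sub>2"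
    and q: "q \<in> Mor C P B" "q \<cdot> r\<^sub>1\<dagger> = Ide C B" "q \<cdot> r\<^sub>2\<dagger> = Ide C B"
    and p: "p \<in> Mor C A P" "r\<^sub>1 \<cdot> p = a" "r\<^sub>2 \<cdot> p = b" and eq: "a \<boxplus> b = q \<cdot> p"
    using add_mor_factors[OF a b] .
  note D = orthonormal_productD[OF P]
  obtain p' where p': "p' \<in> Mor C A P" "r\<^sub>1 \<cdot> p' = c" "r\<^sub>2 \<cdot> p' = d" using pairing[OF P c d] .
  have "(a \<boxplus> c) \<boxplus> (b \<boxplus> d) = q \<cdot> (p \<boxplus> p')"
    by (rule add_mor_eqI[OF P q add_mor_Mor[OF p(1) p'(1)]])
      (simp_all add: Comp_add_mor[OF p(1) p'(1) D(4)] Comp_add_mor[OF p(1) p'(1) D(5)] p p')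
  also have "\<dots> = q \<cdot> p \<boxplus> q \<cdot> p'" by (rule Comp_add_mor[OF p(1) p'(1) q(1)])
  also have "q \<cdot> p' = c \<boxplus> d" using add_mor_eqI[OF P q p'] by simp
  finally show ?thesis using eq by simp
qed

lemma add_mor_assoc:
  assumes a: "a \<in> Mor C A B" and b: "b \<in> Mor C A B" and c: "c \<in> Mor C A B"
  shows "(a \<boxplus> b) \<boxplus> c = a \<boxplus> (b \<boxplus> c)"
proof -
  have z: "zero_mor C A B \<in> Mor C A B" using zero_mor_Mor Mor_Obj[OF a] by blast
  have "(a \<boxplus> b) \<boxplus> (zero_mor C A B \<boxplus> c) = (a \<boxplus> zero_mor C A B) \<boxplus> (b \<boxplus> c)"
    by (rule add_mor_interchange[OF a b z c])
  then show ?thesis using add_mor_zero[OF a] add_mor_zero[OF c] add_mor_commute[OF z c] by simp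
qed

lemma biproduct_expansion:
  assumes P: "orthonormal_product C X\<^sub>1 X\<^sub>2 P r\<^sub>1 r\<^sub>2"
  shows "r\<^sub>1\<dagger> \<cdot> r\<^sub>1 \<boxplus> r\<^sub>2\<dagger> \<cdot> r\<^sub>2 = Ide C P"
proof -
  note D = orthonormal_productD[OF P]
  note rr = Comp_Mor[OF D(4) Adj_Mor[OF D(4)]] Comp_Mor[OF D(5) Adj_Mor[OF D(5)]]
  have z: "zero_mor C P X \<boxplus> f = f" if "f \<in> Mor C P X" for f X
    using add_mor_zero[OF that] add_mor_commute[OF that zero_mor_Mor] Mor_Obj[OF that] by simp
  show ?thesis
    by (rule pairing_unique[OF P add_mor_Mor[OF rr] Ide_Mor[OF D(3)]])
      (simp_all add: Comp_add_mor[OF rr D(4)] Comp_add_mor[OF rr D(5)]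
        Comp_assoc[OF D(4) Adj_Mor[OF D(4)] D(4), symmetric]
        Comp_assoc[OF D(5) Adj_Mor[OF D(5)] D(4), symmetric]
        Comp_assoc[OF D(4) Adj_Mor[OF D(4)] D(5), symmetric]
        Comp_assoc[OF D(5) Adj_Mor[OF D(5)] D(5), symmetric] D
        Ide_Comp[OF D(4)] Ide_Comp[OF D(5)] Comp_Ide[OF D(4)] Comp_Ide[OF D(5)]
        zero_mor_Comp[OF D(4)] zero_mor_Comp[OF D(5)] add_mor_zero[OF D(4)] z[OF D(5)])
qed

text \<open>If \<open>f\<dagger> f + g\<dagger> g = 0\<close>, then the pairing \<open>p\<close> of \<open>f\<close> and \<open>g\<close> satisfies \<open>p\<dagger> p = 0\<close>.\<close>

lemma add_positive_eq_zero:
  assumes f: "f \<in> Mor C A X" and g: "g \<in> Mor C A Y"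
    and eq: "f\<dagger> \<cdot> f \<boxplus> g\<dagger> \<cdot> g = zero_mor C A A"
  shows "f = zero_mor C A X"
proof -
  obtain P r\<^sub>1 r\<^sub>2 where P: "orthonormal_product C X Y P r\<^sub>1 r\<^sub>2"
    using ex_orthonormal_product Mor_Obj f g by meson
  note D = orthonormal_productD[OF P]
  obtain p where p: "p \<in> Mor C A P" "r\<^sub>1 \<cdot> p = f" "r\<^sub>2 \<cdot> p = g" using pairing[OF P f g] .
  have *: "p\<dagger> \<cdot> ((r\<dagger> \<cdot> r) \<cdot> p) = (r \<cdot> p)\<dagger> \<cdot> (r \<cdot> p)" if r: "r \<in> Mor C P Z" for r Z
    using Comp_assoc[OF p(1) r Adj_Mor[OF r]] Adj_Comp[OF p(1) r]
      Comp_assoc[OF Comp_Mor[OF p(1) r] Adj_Mor[OF r] Adj_Mor[OF p(1)]] by simp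
  note rr = Comp_Mor[OF D(4) Adj_Mor[OF D(4)]] Comp_Mor[OF D(5) Adj_Mor[OF D(5)]]
  have "p\<dagger> \<cdot> p = p\<dagger> \<cdot> ((r\<^sub>1\<dagger> \<cdot> r\<^sub>1 \<boxplus> r\<^sub>2\<dagger> \<cdot> r\<^sub>2) \<cdot> p)"
    using biproduct_expansion[OF P] Ide_Comp[OF p(1)] by simp
  also have "\<dots> = p\<dagger> \<cdot> ((r\<^sub>1\<dagger> \<cdot> r\<^sub>1) \<cdot> p) \<boxplus> p\<dagger> \<cdot> ((r\<^sub>2\<dagger> \<cdot> r\<^sub>2) \<cdot> p)"
    using add_mor_Comp[OF rr p(1)]
      Comp_add_mor[OF Comp_Mor[OF p(1) rr(1)] Comp_Mor[OF p(1) rr(2)] Adj_Mor[OF p(1)]] by simp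
  also have "\<dots> = zero_mor C A A" using *[OF D(4)] *[OF D(5)] p eq by simp
  finally have "p = zero_mor C A P" by (rule Adj_Comp_self_eq_zero[OF p(1)])
  then show ?thesis using p(2) Comp_zero_mor[OF D(4) Mor_Obj(1)[OF p(1)]] by simp
qed


section \<open>Additive inverses\<close>

text \<open>
  Let \<open>m = (m\<^sub>1, m\<^sub>2)\<close> be an isometric kernel of the codiagonal \<open>d\<dagger>\<close> and \<open>w = (m\<^sub>2, m\<^sub>1)\<close>, so
  that \<open>m\<^sub>1 + m\<^sub>2 = 0\<close> and \<open>m + w = 0\<close>. The diagonal \<open>d\<close>, being a kernel, is a kernel of
  \<open>m\<dagger>\<close>. As \<open>m\<dagger> (1 + w m\<dagger>) = m\<dagger> (m + w) m\<dagger> = 0\<close>, the morphism \<open>1 + w m\<dagger>\<close> factors through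
  \<open>d\<close>. So the two rows of its matrix agree, and comparing the entries of the first column gives
  \<open>1 + m\<^sub>2 m\<^sub>1\<dagger> = m\<^sub>1 m\<^sub>1\<dagger>\<close>. Adding \<open>m\<^sub>2 m\<^sub>1\<dagger>\<close> yields
  \<open>1 + (m\<^sub>2 m\<^sub>1\<dagger> + m\<^sub>2 m\<^sub>1\<dagger>) = (m\<^sub>1 + m\<^sub>2) m\<^sub>1\<dagger> = 0\<close>.
\<close>

lemma ex_neg_Ide:
  assumes X: "X \<in> Obj C"
  shows "\<exists>n\<in>Mor C X X. Ide C X \<boxplus> n = zero_mor C X X"
proof -
  note I = Ide_Mor[OF X]
  obtain P r\<^sub>1 r\<^sub>2 where P: "orthonormal_product C X X P r\<^sub>1 r\<^sub>2"
    using ex_orthonormal_product X by blast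
  note D = orthonormal_productD[OF P]
  obtain d where d: "d \<in> Mor C X P" "r\<^sub>1 \<cdot> d = Ide C X" "r\<^sub>2 \<cdot> d = Ide C X"
    using pairing[OF P I I] .
  note d' = Adj_Mor[OF d(1)]
  have d'r: "d\<dagger> \<cdot> r\<^sub>1\<dagger> = Ide C X" "d\<dagger> \<cdot> r\<^sub>2\<dagger> = Ide C X"
    using Adj_Comp[OF d(1) D(4)] Adj_Comp[OF d(1) D(5)] d Adj_Ide[OF X] by simp_all
  obtain f where "is_kernel C d f" using diagonal_kernel[OF P d] by blast
  moreover define Y where "Y = Cod C f"
  moreover have "Dom C d = X" "Cod C d = P" using d(1) by (auto simp: Mor_def)
  ultimately have f: "f \<in> Mor C P Y" and fd: "f \<cdot> d = zero_mor C X Y"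
    and ker: "\<And>A g. g \<in> Mor C A P \<Longrightarrow> f \<cdot> g = zero_mor C A Y \<Longrightarrow> \<exists>u\<in>Mor C A X. d \<cdot> u = g"
    using Mor_Obj unfolding is_kernel_def Mor_def by (auto, blast)
  obtain K m where m: "m \<in> Mor C K P" "m\<dagger> \<cdot> m = Ide C K" "d\<dagger> \<cdot> m = zero_mor C K X"
    and univ: "\<And>Y g. g \<in> Mor C Y P \<Longrightarrow> d\<dagger> \<cdot> g = zero_mor C Y X \<Longrightarrow> \<exists>h\<in>Mor C Y K. m \<cdot> h = g"
    by (rule isometric_kernel[OF d'], rule that)
  note m' = Adj_Mor[OF m(1)] and K = Mor_Obj(1)[OF m(1)] and Y = Mor_Obj(2)[OF f]

  \<comment> \<open>The kernel property of \<open>d\<close> transfers from \<open>f\<close> to \<open>m\<dagger>\<close>, since \<open>f\<close> factors through \<open>m\<dagger>\<close>.\<close>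
  have "d\<dagger> \<cdot> f\<dagger> = zero_mor C Y X"
    using Adj_Comp[OF d(1) f] fd Adj_zero_mor[OF X Y] by simp
  then obtain v where v: "v \<in> Mor C Y K" "m \<cdot> v = f\<dagger>" using univ[OF Adj_Mor[OF f]] by blast
  have f_eq: "f = v\<dagger> \<cdot> m\<dagger>" using Adj_Comp[OF v(1) m(1)] v Adj_Adj[OF f] by simp
  have ker_m: "\<exists>u\<in>Mor C A X. d \<cdot> u = g"
    if g: "g \<in> Mor C A P" "m\<dagger> \<cdot> g = zero_mor C A K" for A g
    using ker[OF g(1)] f_eq Comp_assoc[OF g(1) m' Adj_Mor[OF v(1)]] g(2)
      Comp_zero_mor[OF Adj_Mor[OF v(1)] Mor_Obj(1)[OF g(1)]] by simp

  define m1 m2 where "m1 = r\<^sub>1 \<cdot> m" and "m2 = r\<^sub>2 \<cdot> m"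
  have m12: "m1 \<in> Mor C K X" "m2 \<in> Mor C K X"
    using Comp_Mor[OF m(1)] D m1_def m2_def by auto
  have m_sum: "m1 \<boxplus> m2 = zero_mor C K X"
    using add_mor_eqI[OF P d' d'r m(1) m1_def[symmetric] m2_def[symmetric]] m(3) by simp
  obtain w where w: "w \<in> Mor C K P" "r\<^sub>1 \<cdot> w = m2" "r\<^sub>2 \<cdot> w = m1"
    using pairing[OF P m12(2) m12(1)] .
  have mw: "m \<boxplus> w = zero_mor C K P"
    by (rule pairing_unique[OF P add_mor_Mor[OF m(1) w(1)] zero_mor_Mor[OF K D(3)]])
      (simp_all add: Comp_add_mor[OF m(1) w(1) D(4)] Comp_add_mor[OF m(1) w(1) D(5)] w
        m1_def[symmetric] m2_def[symmetric] m_sum add_mor_commute[OF m12(2) m12(1)]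
        Comp_zero_mor[OF D(4) K] Comp_zero_mor[OF D(5) K])

  note IP = Ide_Mor[OF D(3)] and wm = Comp_Mor[OF m' w(1)] and m'w = Comp_Mor[OF w(1) m']
  define e where "e = Ide C P \<boxplus> w \<cdot> m\<dagger>"
  have e: "e \<in> Mor C P P" using add_mor_Mor[OF IP wm] e_def by simp
  have "m\<dagger> \<cdot> e = m\<dagger> \<boxplus> m\<dagger> \<cdot> (w \<cdot> m\<dagger>)"
    using Comp_add_mor[OF IP wm m'] Comp_Ide[OF m'] e_def by simp
  also have "\<dots> = Ide C K \<cdot> m\<dagger> \<boxplus> (m\<dagger> \<cdot> w) \<cdot> m\<dagger>"
    using Ide_Comp[OF m'] Comp_assoc[OF m' w(1) m'] by simp
  also have "\<dots> = (m\<dagger> \<cdot> m \<boxplus> m\<dagger> \<cdot> w) \<cdot> m\<dagger>"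
    using add_mor_Comp[OF Ide_Mor[OF K] m'w m'] m(2) by simp
  also have "\<dots> = (m\<dagger> \<cdot> (m \<boxplus> w)) \<cdot> m\<dagger>" using Comp_add_mor[OF m(1) w(1) m'] by simp
  also have "\<dots> = zero_mor C P K" using mw Comp_zero_mor[OF m' K] zero_mor_Comp[OF m' K] by simp
  finally obtain u where u: "u \<in> Mor C P X" "d \<cdot> u = e" using ker_m[OF e] by blast
  have rows: "r\<^sub>1 \<cdot> e = r\<^sub>2 \<cdot> e"
    using Comp_assoc[OF u(1) d(1) D(4)] Comp_assoc[OF u(1) d(1) D(5)] u d by simp
  have row: "r \<cdot> e = r \<boxplus> (r \<cdot> w) \<cdot> m\<dagger>" if r: "r \<in> Mor C P X" for r
    using Comp_add_mor[OF IP wm r] e_def Comp_Ide[OF r] Comp_assoc[OF m' w(1) r] by simp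
  have m1': "m\<dagger> \<cdot> r\<^sub>1\<dagger> = m1\<dagger>" using Adj_Comp[OF m(1) D(4)] m1_def by simp
  have entry: "(r \<boxplus> n \<cdot> m\<dagger>) \<cdot> r\<^sub>1\<dagger> = r \<cdot> r\<^sub>1\<dagger> \<boxplus> n \<cdot> m1\<dagger>"
    if "r \<in> Mor C P X" "n \<in> Mor C K X" for r n
    using add_mor_Comp[OF that(1) Comp_Mor[OF m' that(2)] Adj_Mor[OF D(4)]]
      Comp_assoc[OF Adj_Mor[OF D(4)] m' that(2)] m1' by simp
  note m1a = Adj_Mor[OF m12(1)]
  note a = Comp_Mor[OF m1a m12(1)] and b = Comp_Mor[OF m1a m12(2)]
  have "(r\<^sub>1 \<boxplus> m2 \<cdot> m\<dagger>) \<cdot> r\<^sub>1\<dagger> = (r\<^sub>2 \<boxplus> m1 \<cdot> m\<dagger>) \<cdot> r\<^sub>1\<dagger>"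
    using rows row[OF D(4)] row[OF D(5)] w by simp
  then have "Ide C X \<boxplus> m2 \<cdot> m1\<dagger> = zero_mor C X X \<boxplus> m1 \<cdot> m1\<dagger>"
    using entry[OF D(4) m12(2)] entry[OF D(5) m12(1)] D by simp
  then have "Ide C X \<boxplus> m2 \<cdot> m1\<dagger> = m1 \<cdot> m1\<dagger>"
    using add_mor_zero[OF a] add_mor_commute[OF a zero_mor_Mor[OF X X]] by simp
  then have "Ide C X \<boxplus> (m2 \<cdot> m1\<dagger> \<boxplus> m2 \<cdot> m1\<dagger>) = m1 \<cdot> m1\<dagger> \<boxplus> m2 \<cdot> m1\<dagger>"
    using add_mor_assoc[OF I b b] by simp
  also have "\<dots> = zero_mor C X X"
    using add_mor_Comp[OF m12 m1a] m_sum zero_mor_Comp[OF m1a X] by simp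
  finally show ?thesis using add_mor_Mor[OF b b] by blast
qed

lemma End_ring_simps [simp]:
  "carrier (End_ring C A) = Mor C A A" "mult (End_ring C A) = Comp C"
  "one (End_ring C A) = Ide C A" "zero (End_ring C A) = zero_mor C A A"
  "add (End_ring C A) = add_mor C"
  by (simp_all add: End_ring_def)

lemma abelian_group_End_ring:
  assumes A: "A \<in> Obj C"
  shows "abelian_group (End_ring C A)"
proof (rule abelian_groupI, simp_all)
  fix x y z assume x: "x \<in> Mor C A A" and y: "y \<in> Mor C A A" and z: "z \<in> Mor C A A"
  show "x \<boxplus> y \<in> Mor C A A" by (rule add_mor_Mor[OF x y])
  show "x \<boxplus> y \<boxplus> z = x \<boxplus> (y \<boxplus> z)" by (rule add_mor_assoc[OF x y z])
  show "x \<boxplus> y = y \<boxplus> x" by (rule add_mor_commute[OF x y])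
next
  show z: "zero_mor C A A \<in> Mor C A A" using zero_mor_Mor A by blast
  fix x assume x: "x \<in> Mor C A A"
  show "zero_mor C A A \<boxplus> x = x" using add_mor_commute[OF z x] add_mor_zero[OF x] by simp
  obtain n where n: "n \<in> Mor C A A" "Ide C A \<boxplus> n = zero_mor C A A" using ex_neg_Ide[OF A] by blast
  have "n \<cdot> x \<boxplus> x = x \<boxplus> n \<cdot> x" by (rule add_mor_commute[OF Comp_Mor[OF x n(1)] x])
  also have "\<dots> = (Ide C A \<boxplus> n) \<cdot> x"
    using add_mor_Comp[OF Ide_Mor[OF A] n(1) x] Ide_Comp[OF x] by simp
  finally have "n \<cdot> x \<boxplus> x = zero_mor C A A" using n zero_mor_Comp[OF x A] by simp
  then show "\<exists>y\<in>Mor C A A. y \<boxplus> x = zero_mor C A A" using Comp_Mor[OF x n(1)] by blast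
qed


section \<open>\<open>\<ell>\<^sup>2\<close>-products\<close>

lemma carrier_Herm_order: "a \<in> carrier (Herm_order C A) \<longleftrightarrow> a \<in> Mor C A A \<and> a\<dagger> = a"
  by (simp add: Herm_order_def)

lemma Herm_order_leI:
  assumes "A \<in> Obj C" "f \<in> Mor C A A" "h \<in> Mor C A X" "g = h\<dagger> \<cdot> h \<boxplus> f"
  shows "f \<sqsubseteq>\<^bsub>Herm_order C A\<^esub> g"
proof -
  interpret E: abelian_group "End_ring C A" by (rule abelian_group_End_ring[OF assms(1)])
  have hh: "h\<dagger> \<cdot> h \<in> Mor C A A" using Comp_Mor[OF assms(3) Adj_Mor[OF assms(3)]] .
  have "g \<ominus>\<^bsub>End_ring C A\<^esub> f = h\<dagger> \<cdot> h"
    using E.add.inv_solve_right'[of "h\<dagger> \<cdot> h" g f] assms(2,4) hh add_mor_Mor[OF hh assms(2)]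
    by (simp add: a_minus_def a_inv_def)
  then show ?thesis using assms(3) Mor_Obj by (auto simp: Herm_order_def)
qed

lemma Herm_order_leE:
  assumes le: "f \<sqsubseteq>\<^bsub>Herm_order C A\<^esub> g" and A: "A \<in> Obj C" and f: "f \<in> Mor C A A" and g: "g \<in> Mor C A A"
  obtains X h where "h \<in> Mor C A X" "g = h\<dagger> \<cdot> h \<boxplus> f"
proof -
  interpret E: abelian_group "End_ring C A" by (rule abelian_group_End_ring[OF A])
  obtain X h where h: "h \<in> Mor C A X" "g \<ominus>\<^bsub>End_ring C A\<^esub> f = h\<dagger> \<cdot> h"
    using le by (auto simp: Herm_order_def)
  have hh: "h\<dagger> \<cdot> h \<in> Mor C A A" using Comp_Mor[OF h(1) Adj_Mor[OF h(1)]] .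
  have "g = h\<dagger> \<cdot> h \<boxplus> f"
    using E.add.inv_solve_right'[of "h\<dagger> \<cdot> h" g f] h(2) hh f g
    by (simp add: a_minus_def a_inv_def)
  then show ?thesis using that h by blast
qed

lemma zero_Ide_le_Ide:
  assumes A: "A \<in> Obj C"
  shows "zero_mor C A A \<sqsubseteq>\<^bsub>Herm_order C A\<^esub> Ide C A" and "Ide C A \<sqsubseteq>\<^bsub>Herm_order C A\<^esub> Ide C A"
proof -
  note I = Ide_Mor[OF A] and z = zero_mor_Mor[OF A A]
  show "zero_mor C A A \<sqsubseteq>\<^bsub>Herm_order C A\<^esub> Ide C A"
    using Herm_order_leI[OF A z I] Adj_Ide[OF A] Ide_Comp[OF I] add_mor_zero[OF I] by simp
  show "Ide C A \<sqsubseteq>\<^bsub>Herm_order C A\<^esub> Ide C A"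
    using Herm_order_leI[OF A I z] Comp_zero_mor[OF Adj_Mor[OF z] A] add_mor_zero[OF I]
      add_mor_commute[OF I z] by simp
qed

text \<open>The component \<open>X\<^sub>k \<rightarrow> X\<^sub>j\<close> of the span that is the identity at \<open>k\<close> and zero elsewhere.\<close>

definition delta where
  "delta X k j = (if j = k then Ide C (X j) else zero_mor C (X k) (X j))"

text \<open>
  A finite partial sum of \<open>\<delta>\<^sub>j\<^sub>k\<dagger> \<delta>\<^sub>j\<^sub>k\<close> is \<open>1\<close> or \<open>0\<close>, according to whether \<open>k\<close> is among the
  indices.
\<close>

lemma Ide_upper_delta:
  assumes X: "\<And>j. j \<in> J \<Longrightarrow> X j \<in> Obj C" and k: "k \<in> J"
  shows "Ide C (X k) \<in> Upper (Herm_order C (X k))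
           (partial_sums C (X k) J (\<lambda>j. (delta X k j)\<dagger> \<cdot> delta X k j))"
proof -
  interpret E: abelian_group "End_ring C (X k)" by (rule abelian_group_End_ring[OF X[OF k]])
  note I = Ide_Mor[OF X[OF k]]
  have val: "(delta X k j)\<dagger> \<cdot> delta X k j
      = (if k = j then Ide C (X k) else zero_mor C (X k) (X k))" if "j \<in> J" for j
    using Adj_Ide[OF X[OF k]] Ide_Comp[OF I]
      Comp_zero_mor[OF Adj_Mor[OF zero_mor_Mor[OF X[OF k] X[OF that]]] X[OF k]]
    by (cases "j = k") (simp_all add: delta_def)
  have "finsum (End_ring C (X k)) (\<lambda>j. (delta X k j)\<dagger> \<cdot> delta X k j) F
      \<sqsubseteq>\<^bsub>Herm_order C (X k)\<^esub> Ide C (X k)" if F: "F \<in> Fpow J" for F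
  proof -
    have "finsum (End_ring C (X k)) (\<lambda>j. (delta X k j)\<dagger> \<cdot> delta X k j) F
        = finsum (End_ring C (X k)) (\<lambda>j. if k = j then Ide C (X k) else zero_mor C (X k) (X k)) F"
      using F I zero_mor_Mor[OF X[OF k] X[OF k]] val
      by (intro E.finsum_cong') (auto simp: Fpow_def)
    also have "\<dots> = (if k \<in> F then Ide C (X k) else zero_mor C (X k) (X k))"
    proof (cases "k \<in> F")
      case True
      then show ?thesis
        using E.finsum_singleton[of k F "\<lambda>_. Ide C (X k)"] F I by (simp add: Fpow_def cong: if_cong)
    next
      case False
      have "finsum (End_ring C (X k))
          (\<lambda>j. if k = j then Ide C (X k) else zero_mor C (X k) (X k)) F = \<zero>\<^bsub>End_ring C (X k)\<^esub>"
        by (rule E.add.finprod_one_eqI) (use False in auto)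
      then show ?thesis using False by simp
    qed
    finally show ?thesis using zero_Ide_le_Ide[OF X[OF k]] by simp
  qed
  then show ?thesis
    using I Adj_Ide[OF X[OF k]]
    by (auto simp: Upper_def partial_sums_def carrier_Herm_order)
qed

lemma l2_product_is_sum_Ide:
  assumes "l2_product C J X P r"
  shows "is_sum C P J (\<lambda>j. (r j)\<dagger> \<cdot> r j) (Ide C P)"
proof -
  have span: "l2_span C J X P r" using assms by (simp add: l2_product_def)
  then have P: "P \<in> Obj C" and r: "\<And>j. j \<in> J \<Longrightarrow> r j \<in> Mor C P (X j)"
    by (auto simp: l2_span_def is_span_def)
  have "is_sum C P J (\<lambda>j. (r j)\<dagger> \<cdot> r j) ((Ide C P)\<dagger> \<cdot> Ide C P)"
    using assms span Ide_Mor[OF P] Comp_Ide[OF r] unfolding l2_product_def by blast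
  then show ?thesis using Adj_Ide[OF P] Ide_Comp[OF Ide_Mor[OF P]] by simp
qed

lemma is_sum_term_le:
  assumes s: "is_sum C A J (\<lambda>j. (g j)\<dagger> \<cdot> g j) s" and k: "k \<in> J" and g: "g k \<in> Mor C A B"
  shows "(g k)\<dagger> \<cdot> g k \<sqsubseteq>\<^bsub>Herm_order C A\<^esub> s"
proof -
  interpret E: abelian_group "End_ring C A" by (rule abelian_group_End_ring[OF Mor_Obj(1)[OF g]])
  have gg: "(g k)\<dagger> \<cdot> g k \<in> Mor C A A" using Comp_Mor[OF g Adj_Mor[OF g]] .
  have "finsum (End_ring C A) (\<lambda>j. (g j)\<dagger> \<cdot> g j) {k} = (g k)\<dagger> \<cdot> g k"
    using E.finsum_insert[of "{}" k "\<lambda>j. (g j)\<dagger> \<cdot> g j"] gg add_mor_zero[OF gg] by simp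
  then have "(g k)\<dagger> \<cdot> g k \<in> partial_sums C A J (\<lambda>j. (g j)\<dagger> \<cdot> g j)"
    using k unfolding partial_sums_def Fpow_def by force
  moreover have "(g k)\<dagger> \<cdot> g k \<in> carrier (Herm_order C A)"
    using gg Adj_Comp[OF g Adj_Mor[OF g]] Adj_Adj[OF g] by (simp add: carrier_Herm_order)
  ultimately show ?thesis using s by (auto simp: is_sum_def least_def Upper_def)
qed

text \<open>
  A section \<open>s\<close> of \<open>r\<close> with \<open>s\<dagger> s \<le> 1\<close> and \<open>r\<dagger> r \<le> 1\<close> is \<open>r\<dagger>\<close>.
\<close>

lemma contractive_section_eq_Adj:
  assumes r: "r \<in> Mor C P A" and s: "s \<in> Mor C A P" and rs: "r \<cdot> s = Ide C A"
    and r_le: "r\<dagger> \<cdot> r \<sqsubseteq>\<^bsub>Herm_order C P\<^esub> Ide C P"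
    and s_le: "s\<dagger> \<cdot> s \<sqsubseteq>\<^bsub>Herm_order C A\<^esub> Ide C A"
  shows "s = r\<dagger>"
proof -
  note A = Mor_Obj(1)[OF s] and P = Mor_Obj(2)[OF s]
  note r' = Adj_Mor[OF r] and s' = Adj_Mor[OF s]
  note rr = Comp_Mor[OF r r'] and ss = Comp_Mor[OF s s']
  interpret E: abelian_group "End_ring C A" by (rule abelian_group_End_ring[OF A])
  obtain X h where h: "h \<in> Mor C P X" and h_eq: "Ide C P = h\<dagger> \<cdot> h \<boxplus> r\<dagger> \<cdot> r"
    using Herm_order_leE[OF r_le P rr Ide_Mor[OF P]] by metis
  obtain Y t where t: "t \<in> Mor C A Y" and t_eq: "Ide C A = t\<dagger> \<cdot> t \<boxplus> s\<dagger> \<cdot> s"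
    using Herm_order_leE[OF s_le A ss Ide_Mor[OF A]] by metis
  note h' = Adj_Mor[OF h] and t' = Adj_Mor[OF t] and hs = Comp_Mor[OF s h]
  note hh = Comp_Mor[OF h h'] and tt = Comp_Mor[OF t t'] and hshs = Comp_Mor[OF hs Adj_Mor[OF hs]]
  have s_eq: "s = h\<dagger> \<cdot> (h \<cdot> s) \<boxplus> r\<dagger>"
    using add_mor_Comp[OF hh rr s] h_eq Ide_Comp[OF s] Comp_assoc[OF s h h'] Comp_assoc[OF s r r']
      rs Comp_Ide[OF r'] by simp
  have "s\<dagger> \<cdot> r\<dagger> = Ide C A" using Adj_Comp[OF s r] rs Adj_Ide[OF A] by simp
  moreover have "s\<dagger> \<cdot> (h\<dagger> \<cdot> (h \<cdot> s)) = (h \<cdot> s)\<dagger> \<cdot> (h \<cdot> s)"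
    using Adj_Comp[OF s h] Comp_assoc[OF hs h' s'] by simp
  ultimately have "s\<dagger> \<cdot> s = (h \<cdot> s)\<dagger> \<cdot> (h \<cdot> s) \<boxplus> Ide C A"
    using arg_cong[OF s_eq, of "\<lambda>x. s\<dagger> \<cdot> x"] Comp_add_mor[OF Comp_Mor[OF hs h'] r' s'] by simp
  also have "\<dots> = ((h \<cdot> s)\<dagger> \<cdot> (h \<cdot> s) \<boxplus> t\<dagger> \<cdot> t) \<boxplus> s\<dagger> \<cdot> s"
    using t_eq add_mor_assoc[OF hshs tt ss] by simp
  finally have "(h \<cdot> s)\<dagger> \<cdot> (h \<cdot> s) \<boxplus> t\<dagger> \<cdot> t = zero_mor C A A"
    using E.add.r_cancel_one'[of "s\<dagger> \<cdot> s" "(h \<cdot> s)\<dagger> \<cdot> (h \<cdot> s) \<boxplus> t\<dagger> \<cdot> t"] ss add_mor_Mor[OF hshs tt]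
    by simp
  then have "h \<cdot> s = zero_mor C A X" by (rule add_positive_eq_zero[OF hs t])
  then show ?thesis
    using s_eq Comp_zero_mor[OF h' A] add_mor_zero[OF r'] add_mor_commute[OF r' zero_mor_Mor[OF A P]]
    by simp
qed

lemma l2_product_imp_l2_biproduct:
  assumes X: "\<And>j. j \<in> J \<Longrightarrow> X j \<in> Obj C" and prod: "l2_product C J X P r"
  shows "l2_biproduct C J X P r"
proof -
  note sum = l2_product_is_sum_Ide[OF prod]
  have span: "is_span C J X P r" using prod by (simp add: l2_product_def l2_span_def)
  then have r: "\<And>j. j \<in> J \<Longrightarrow> r j \<in> Mor C P (X j)" by (simp add: is_span_def)
  have "r j \<cdot> (r k)\<dagger> = delta X k j" if j: "j \<in> J" and k: "k \<in> J" for j k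
  proof -
    have "is_span C J X (X k) (delta X k)"
      using X k Ide_Mor zero_mor_Mor by (simp add: is_span_def delta_def)
    then have "l2_span C J X (X k) (delta X k)"
      using Ide_upper_delta[where J = J and X = X, OF X k] unfolding l2_span_def by blast
    then obtain s where s: "s \<in> Mor C (X k) P" and rs: "\<And>i. i \<in> J \<Longrightarrow> r i \<cdot> s = delta X k i"
      and s_sum: "is_sum C (X k) J (\<lambda>i. (delta X k i)\<dagger> \<cdot> delta X k i) (s\<dagger> \<cdot> s)"
      using prod unfolding l2_product_def by blast
    have "s\<dagger> \<cdot> s \<sqsubseteq>\<^bsub>Herm_order C (X k)\<^esub> Ide C (X k)"
      using s_sum Ide_upper_delta[where J = J and X = X, OF X k] by (simp add: is_sum_def least_def)
    then have "s = (r k)\<dagger>"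
      using contractive_section_eq_Adj[OF r[OF k] s _ is_sum_term_le[OF sum k r[OF k]]] rs[OF k]
      by (simp add: delta_def)
    then show ?thesis using rs[OF j] by simp
  qed
  then show ?thesis using span sum by (simp add: l2_biproduct_def delta_def)
qed

end

theorem proposition4p11:
  fixes C :: "('o, 'm, 'z) star_structure_scheme"
    and J :: "'j set" and X :: "'j \<Rightarrow> 'o" and P :: 'o and r :: "'j \<Rightarrow> 'm"
  assumes "pre_hilbert_star_category C"
    and "\<And>j. j \<in> J \<Longrightarrow> X j \<in> Obj C"
    and "l2_product C J X P r"
  shows "l2_biproduct C J X P r"
  using pre_hilbert_star_category.l2_product_imp_l2_biproduct[OF assms] .

end
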